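(* Let $n\ge 3$, let $x\in\mathbb{C}$ and let $\mathbf{i}=\sqrt{-1}$. Let $A_n$ be the $n\times n$ anti-tridiagonal matrix with $(A_n)_{i,n+1-i}=x$ for all $i$, $(A_n)_{1,n-1}=(A_n)_{n,2}=2\mathbf{i}$, $(A_n)_{2,n}=(A_n)_{n-1,1}=\mathbf{i}$, all other entries $(A_n)_{i,j}$ with $|i+j-(n+1)|=1$ equal to $-\mathbf{i}$, and all remaining entries $0$. Then $$\det(A_n)=\begin{cases}(x^2+4)F_{n-1}(x), & n\equiv 0 \text{ or } 1 \pmod 4,\\ -(x^2+4)F_{n-1}(x), & n\equiv 2\text{ or } 3\pmod 4.\end{cases}$$
   Context: $F_n(x)$ are the Fibonacci polynomials: $F_0(x)=0$, $F_1(x)=1$, $F_n(x)=xF_{n-1}(x)+F_{n-2}(x)$ for $n\ge2$. The matrix $A_n$ is the anti-tridiagonal matrix with parameters $a=x$, $b=\mathbf{i}$ (diagonal-type entry $a$ on the anti-diagonal, $2b$ and $b$ at the ends of the adjacent anti-diagonals, $-b$ elsewhere on them). *)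

theory Defs
  imports Complex_Main "HOL-Computational_Algebra.Polynomial" "Jordan_Normal_Form.Determinant"
begin

fun fib_poly :: "nat \<Rightarrow> 'a::comm_ring_1 poly" where
  "fib_poly 0 = 0"
| "fib_poly (Suc 0) = 1"
| "fib_poly (Suc (Suc n)) = [:0, 1:] * fib_poly (Suc n) + fib_poly n"

text \<open>The row and column indices \<open>i\<close>, \<open>j\<close> of this entry function run over \<open>1, \<dots>, n\<close>.\<close>

definition anti_tridiag_entry ::
    "nat \<Rightarrow> 'a::comm_ring_1 \<Rightarrow> 'a \<Rightarrow> nat \<Rightarrow> nat \<Rightarrow> 'a" where
  "anti_tridiag_entry n a b i j =
     (if i + j = n + 1 then a
      else if (i, j) = (1, n - 1) \<or> (i, j) = (n, 2) then 2 * b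
      else if (i, j) = (2, n) \<or> (i, j) = (n - 1, 1) then b
      else if \<bar>int i + int j - int (n + 1)\<bar> = 1 then - b
      else 0)"

text \<open>Matrices of the library are indexed from 0, hence the shift by one.\<close>

definition anti_tridiag_mat :: "nat \<Rightarrow> 'a::comm_ring_1 \<Rightarrow> 'a \<Rightarrow> 'a mat" where
  "anti_tridiag_mat n a b = mat n n (\<lambda>(i, j). anti_tridiag_entry n a b (i + 1) (j + 1))"

end

theory Submission
  imports Defs
begin

text \<open>Reversing the columns of an anti-tridiagonal matrix of size \<open>n\<close> costs the sign
  \<open>(-1) ^ (n choose 2)\<close> and yields a tridiagonal matrix, whose determinant is a continuant: it only
  depends on the diagonal and on the products of opposite off-diagonal entries. Here these products
  are \<open>-2, -1, \<dots>, -1, -2\<close>. The leading \<open>-2\<close> turns the continuants of size \<open>k < n\<close> into the Lucas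
  polynomials \<open>F (k + 1) + F (k - 1)\<close>, and the last one gives
  \<open>x (F n + F (n - 2)) + 2 (F (n - 1) + F (n - 3)) = (x\<^sup>2 + 4) F (n - 1)\<close>.\<close>

fun continuant :: "(nat \<Rightarrow> 'a::comm_ring_1) \<Rightarrow> (nat \<Rightarrow> 'a) \<Rightarrow> nat \<Rightarrow> 'a" where
  "continuant d p 0 = 1"
| "continuant d p (Suc 0) = d 0"
| "continuant d p (Suc (Suc k)) = d (Suc k) * continuant d p (Suc k) - p k * continuant d p k"

text \<open>After reversal of the columns, \<open>d i\<close>, \<open>u i\<close> and \<open>l i\<close> are the entries at
  \<open>(i, i)\<close>, \<open>(i, i + 1)\<close> and \<open>(i + 1, i)\<close>, counted from 0.\<close>

definition gen_anti_tridiag ::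
    "(nat \<Rightarrow> 'a::comm_ring_1) \<Rightarrow> (nat \<Rightarrow> 'a) \<Rightarrow> (nat \<Rightarrow> 'a) \<Rightarrow> nat \<Rightarrow> 'a mat" where
  "gen_anti_tridiag d u l n = mat n n (\<lambda>(i, j).
     if Suc (i + j) = n then d i
     else if Suc (Suc (i + j)) = n then u i
     else if i + j = n then l (i - 1)
     else 0)"

lemma gen_anti_tridiag_carrier [simp]: "gen_anti_tridiag d u l n \<in> carrier_mat n n"
  by (simp add: gen_anti_tridiag_def)

text \<open>Laplace expansion along the last row, which holds only \<open>d (Suc k)\<close> and
  \<open>l k\<close>; the minor belonging to \<open>l k\<close> has the single entry
  \<open>u k\<close> in its first column.\<close>

lemma det_gen_anti_tridiag_Suc_Suc:
  "det (gen_anti_tridiag d u l (Suc (Suc k))) =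
     (-1) ^ Suc k * d (Suc k) * det (gen_anti_tridiag d u l (Suc k))
     + u k * l k * det (gen_anti_tridiag d u l k)"
proof -
  let ?M = "gen_anti_tridiag d u l"
  let ?A = "?M (Suc (Suc k))"
  let ?B = "mat_delete ?A (Suc k) 1"
  \<comment> \<open>All entries are indexed by row, so removing the last row and the first column
    keeps \<open>d\<close>, \<open>u\<close> and \<open>l\<close> unshifted.\<close>
  have del0: "mat_delete ?A (Suc k) 0 = ?M (Suc k)"
    by (rule eq_matI) (auto simp: mat_delete_def gen_anti_tridiag_def)
  have B: "?B \<in> carrier_mat (Suc k) (Suc k)"
    by (simp add: mat_delete_def gen_anti_tridiag_def)
  have delB: "mat_delete ?B k 0 = ?M k"
    by (rule eq_matI) (auto simp: mat_delete_def gen_anti_tridiag_def)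
  have "det ?B = (\<Sum>i<Suc k. ?B $$ (i, 0) * cofactor ?B i 0)"
    using B by (rule laplace_expansion_column) simp
  also have "\<dots> = (\<Sum>i\<in>{k}. ?B $$ (i, 0) * cofactor ?B i 0)"
    by (rule sum.mono_neutral_right) (auto simp: mat_delete_def gen_anti_tridiag_def)
  also have "\<dots> = u k * cofactor ?B k 0"
    by (simp add: mat_delete_def gen_anti_tridiag_def)
  finally have detB: "det ?B = u k * ((-1) ^ k * det (?M k))"
    using delB by (simp add: cofactor_def)
  have "det ?A = (\<Sum>j<Suc (Suc k). ?A $$ (Suc k, j) * cofactor ?A (Suc k) j)"
    by (rule laplace_expansion_row) simp_all
  also have "\<dots> = (\<Sum>j\<in>{0, 1}. ?A $$ (Suc k, j) * cofactor ?A (Suc k) j)"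
    by (rule sum.mono_neutral_right) (auto simp: gen_anti_tridiag_def)
  also have "\<dots> = d (Suc k) * cofactor ?A (Suc k) 0 + l k * cofactor ?A (Suc k) 1"
    by (simp add: gen_anti_tridiag_def)
  also have "\<dots> = (-1) ^ Suc k * d (Suc k) * det (?M (Suc k))
      + ((-1) ^ k * (-1) ^ k) * (u k * l k * det (?M k))"
    using del0 detB by (simp add: cofactor_def algebra_simps)
  also have "(-1) ^ k * (-1) ^ k = (1::'a)"
    by (simp flip: power_mult_distrib)
  finally show ?thesis by simp
qed

lemma det_gen_anti_tridiag:
  "det (gen_anti_tridiag d u l k) = (-1) ^ (k choose 2) * continuant d (\<lambda>i. u i * l i) k"
proof (induction d "\<lambda>i. u i * l i" k rule: continuant.induct)
  case (1 d)
  show ?case by (simp add: det_dim_zero numeral_2_eq_2)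
next
  case (2 d)
  show ?case
    by (simp add: det_single gen_anti_tridiag_def numeral_2_eq_2)
next
  case (3 d k)
  \<comment> \<open>By Pascal's rule, the binomial coefficient grows by \<open>k\<close> in one step
    and by the odd number \<open>2 * k + 1\<close> in two.\<close>
  have sgn: "(-1) ^ (Suc k choose 2) = ((-1) ^ (k choose 2) * (-1) ^ k :: 'a)"
      "(-1) ^ (Suc (Suc k) choose 2) = - ((-1) ^ (k choose 2) :: 'a)"
    by (simp_all add: numeral_2_eq_2 power_add mult.assoc)
  have "(-1) ^ Suc k * ((-1) ^ (k choose 2) * (-1) ^ k) = - ((-1) ^ (k choose 2) :: 'a)"
    by (cases "even k") simp_all
  then show ?case
    unfolding det_gen_anti_tridiag_Suc_Suc 3 sgn continuant.simps
    by (simp add: algebra_simps)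
qed

text \<open>Products \<open>- 1\<close> make the continuant recurrence that of
  \<open>fib_poly\<close>, and \<open>p 0 = - 2\<close> sets the start values \<open>x\<close> and
  \<open>x\<^sup>2 + 2\<close>. Size \<open>Suc k\<close> involves \<open>p\<close> only below
  \<open>k\<close>, so the exceptional last product can be treated separately.\<close>

lemma continuant_lucas:
  assumes "\<And>i. i < k \<Longrightarrow> p i = (if i = 0 then - 2 else - 1)"
  shows "continuant (\<lambda>_. x) p (Suc k) = poly (fib_poly (Suc (Suc k)) + fib_poly k) x"
  using assms
proof (induction k rule: fib_poly.induct)
  case (3 k)
  have "continuant (\<lambda>_. x) p (Suc (Suc (Suc k)))
      = x * continuant (\<lambda>_. x) p (Suc (Suc k)) + continuant (\<lambda>_. x) p (Suc k)"
    using "3.prems"[of "Suc k"] by simp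
  also have "\<dots> = x * poly (fib_poly (Suc (Suc (Suc k))) + fib_poly (Suc k)) x
      + poly (fib_poly (Suc (Suc k)) + fib_poly k) x"
    using "3.IH" "3.prems" by simp
  finally show ?case by (simp add: algebra_simps)
qed (simp_all add: algebra_simps)

text \<open>Translates the sign of the column reversal into residues modulo 4.\<close>

lemma even_choose_two_iff: "even (n choose 2) \<longleftrightarrow> n mod 4 = 0 \<or> n mod 4 = 1"
proof -
  define q r where "q = n div 4" and "r = n mod 4"
  have n: "n = 4 * q + r" and "r < 4"
    by (simp_all add: q_def r_def)
  then consider "r = 0" | "r = 1" | "r = 2" | "r = 3" by linarith
  then have "even (n choose 2) \<longleftrightarrow> r = 0 \<or> r = 1"
  proof cases
    case 1
    then have "n choose 2 = 2 * (q * (4 * q - 1))"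
      using n by (simp add: choose_two)
    then show ?thesis using 1 by simp
  next
    case 2
    then have "n choose 2 = 2 * (q * (4 * q + 1))"
      using n by (simp add: choose_two)
    then show ?thesis using 2 by simp
  next
    case 3
    then have "n * (n - 1) = 2 * (2 * (4 * q * q + 3 * q) + 1)"
      using n by (simp add: algebra_simps)
    then have "n choose 2 = 2 * (4 * q * q + 3 * q) + 1"
      by (simp add: choose_two)
    then show ?thesis using 3 by simp
  next
    case 4
    then have "n * (n - 1) = 2 * (2 * (4 * q * q + 5 * q + 1) + 1)"
      using n by (simp add: algebra_simps)
    then have "n choose 2 = 2 * (4 * q * q + 5 * q + 1) + 1"
      by (simp add: choose_two)
    then show ?thesis using 4 by simp
  qed
  then show ?thesis by (simp add: r_def)
qed

text \<open>The special entries sit at the ends \<open>0\<close> and \<open>n - 2\<close> of the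
  adjacent anti-diagonals, which are distinct for \<open>n \<ge> 3\<close>.\<close>

lemma anti_tridiag_mat_eq_gen:
  assumes "n \<ge> 3"
  shows "anti_tridiag_mat n a b =
    gen_anti_tridiag (\<lambda>_. a) (\<lambda>i. if i = 0 then 2 * b else if i = n - 2 then b else - b)
      (\<lambda>i. if i = 0 then b else if i = n - 2 then 2 * b else - b) n"
    (is "_ = gen_anti_tridiag ?d ?u ?l n")
proof (rule eq_matI)
  fix i j
  assume "i < dim_row (gen_anti_tridiag ?d ?u ?l n)" "j < dim_col (gen_anti_tridiag ?d ?u ?l n)"
  then have ij: "i < n" "j < n"
    by (simp_all add: gen_anti_tridiag_def)
  have off: "\<bar>int (i + 1) + int (j + 1) - int (n + 1)\<bar> = 1 \<longleftrightarrow> Suc (Suc (i + j)) = n \<or> i + j = n"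
    by arith
  consider "Suc (i + j) = n" | "Suc (Suc (i + j)) = n" | "i + j = n"
    | "Suc (i + j) \<noteq> n" "Suc (Suc (i + j)) \<noteq> n" "i + j \<noteq> n"
    by blast
  then have "anti_tridiag_entry n a b (i + 1) (j + 1) =
      (if Suc (i + j) = n then ?d i else if Suc (Suc (i + j)) = n then ?u i
       else if i + j = n then ?l (i - 1) else 0)"
  proof cases
    case 1
    then show ?thesis unfolding anti_tridiag_entry_def by simp
  next
    case 2
    then have "(i + 1, j + 1) = (1, n - 1) \<longleftrightarrow> i = 0" "(i + 1, j + 1) \<noteq> (n, 2)"
        "(i + 1, j + 1) \<noteq> (2, n)" "(i + 1, j + 1) = (n - 1, 1) \<longleftrightarrow> i = n - 2"
      unfolding prod.inject by arith+
    then show ?thesis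
      using 2 by (simp only: anti_tridiag_entry_def off) auto
  next
    case 3
    \<comment> \<open>Here \<open>i + j = n\<close> and \<open>j < n\<close> force
      \<open>i > 0\<close>, so \<open>i - 1\<close> is not truncated.\<close>
    then have "(i + 1, j + 1) \<noteq> (1, n - 1)" "(i + 1, j + 1) = (n, 2) \<longleftrightarrow> i - 1 = n - 2"
        "(i + 1, j + 1) = (2, n) \<longleftrightarrow> i - 1 = 0" "(i + 1, j + 1) \<noteq> (n - 1, 1)"
      using ij assms unfolding prod.inject by arith+
    then show ?thesis
      using 3 assms by (simp only: anti_tridiag_entry_def off) auto
  next
    case 4
    then have "(i + 1, j + 1) \<noteq> (1, n - 1)" "(i + 1, j + 1) \<noteq> (n, 2)"
        "(i + 1, j + 1) \<noteq> (2, n)" "(i + 1, j + 1) \<noteq> (n - 1, 1)"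
      using ij assms unfolding prod.inject by arith+
    then show ?thesis
      using 4 by (simp only: anti_tridiag_entry_def off) auto
  qed
  with ij show "anti_tridiag_mat n a b $$ (i, j) = gen_anti_tridiag ?d ?u ?l n $$ (i, j)"
    by (simp add: anti_tridiag_mat_def gen_anti_tridiag_def)
qed (simp_all add: anti_tridiag_mat_def gen_anti_tridiag_def)

lemma det_anti_tridiag_mat:
  fixes x :: complex
  assumes "n \<ge> 3"
  shows "det (anti_tridiag_mat n x \<i>) =
    (-1) ^ (n choose 2) * ((x\<^sup>2 + 4) * poly (fib_poly (n - 1)) x)"
proof -
  define p :: "nat \<Rightarrow> complex" where "p = (\<lambda>i.
    (if i = 0 then 2 * \<i> else if i = n - 2 then \<i> else - \<i>) *
    (if i = 0 then \<i> else if i = n - 2 then 2 * \<i> else - \<i>))"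
  obtain k where n: "n = Suc (Suc (Suc k))"
    using assms that[of "n - 3"] by simp
  have p: "p i = (if i = 0 then - 2 else - 1)" if "i < Suc k" for i
    using that n by (simp add: p_def)
  have plast: "p (Suc k) = - 2"
    using n by (simp add: p_def)
  have "continuant (\<lambda>_. x) p n
      = x * poly (fib_poly (Suc (Suc (Suc k))) + fib_poly (Suc k)) x
        + 2 * poly (fib_poly (Suc (Suc k)) + fib_poly k) x"
    using continuant_lucas[of "Suc k" p x] continuant_lucas[of k p x] p plast
    by (simp add: n)
  \<comment> \<open>Two uses of the recurrence: \<open>x * F n\<close> yields
    \<open>x\<^sup>2 * F (n - 1) + x * F (n - 2)\<close>, and the remaining
    \<open>2 * (x * F (n - 2) + F (n - 3))\<close> is \<open>2 * F (n - 1)\<close>.\<close>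
  also have "\<dots> = (x\<^sup>2 + 4) * poly (fib_poly (n - 1)) x"
    by (simp add: n algebra_simps power2_eq_square)
  finally show ?thesis
    by (simp add: anti_tridiag_mat_eq_gen[OF assms] det_gen_anti_tridiag p_def)
qed

theorem theorem9:
  fixes n :: nat and x :: complex
  assumes "n \<ge> 3"
  shows "(n mod 4 = 0 \<or> n mod 4 = 1 \<longrightarrow>
            det (anti_tridiag_mat n x \<i>) = (x\<^sup>2 + 4) * poly (fib_poly (n - 1)) x) \<and>
         (n mod 4 = 2 \<or> n mod 4 = 3 \<longrightarrow>
            det (anti_tridiag_mat n x \<i>) = - (x\<^sup>2 + 4) * poly (fib_poly (n - 1)) x)"
proof -
  have "odd (n choose 2)" if "n mod 4 = 2 \<or> n mod 4 = 3"
    using that even_choose_two_iff[of n] by auto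
  then show ?thesis
    using det_anti_tridiag_mat[OF assms, of x] even_choose_two_iff[of n]
    by (auto simp: algebra_simps)
qed

end
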